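(* Let $O$ be an order and let $P$ be a regular prime ideal of $O$. Then there exists an idempotent pair of elements of $O$ that generates $P$. In particular, if $O$ is integrally closed, then every prime ideal of $O$ is generated by an idempotent pair.
   Context: An integral domain $O$ is an order if its integral closure $D$ in its quotient field is a Dedekind domain which is finitely generated as an $O$-module; orders are one-dimensional Noetherian domains (Dedekind domains are understood not to be fields). The conductor of $D$ over $O$ is $\mathfrak{f}=(O:D)=\{x\in O\mid xD\subseteq O\}$. An ideal $I$ of $O$ is regular if it is comaximal with the conductor, i.e. $I+\mathfrak{f}=O$. Two elements $a,b$ of an integral domain $R$ form an idempotent pair if either $a(1-a)\in bR$ or $b(1-b)\in aR$. *)

theory Defs
  imports "HOL-Algebra.Algebra"
begin

text \<open>
  A domain is represented as a subring \<open>A\<close> of an arbitrary field \<open>K\<close> that is its quotient field;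
  as a ring in its own right it is the record \<open>K\<lparr>carrier := A\<rparr>\<close>.
\<close>

definition quotient_field_of :: "('a, 'b) ring_scheme \<Rightarrow> 'a set \<Rightarrow> bool" where
  "quotient_field_of K A \<longleftrightarrow> field K \<and> subring A K \<and>
     (\<forall>x\<in>carrier K. \<exists>a\<in>A. \<exists>b\<in>A - {\<zero>\<^bsub>K\<^esub>}. x = a \<otimes>\<^bsub>K\<^esub> inv\<^bsub>K\<^esub> b)"

text \<open>
  Polynomials are coefficient lists with the leading coefficient first, and the zero polynomial is
  \<open>[]\<close>; it has to be excluded explicitly, because \<open>lead_coeff []\<close> is unspecified.
\<close>

definition integral_closure :: "('a, 'b) ring_scheme \<Rightarrow> 'a set \<Rightarrow> 'a set" where
  "integral_closure K A = {x \<in> carrier K. \<exists>p \<in> carrier (univ_poly K A).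
     p \<noteq> [] \<and> lead_coeff p = \<one>\<^bsub>K\<^esub> \<and> ring.eval K p x = \<zero>\<^bsub>K\<^esub>}"

definition integrally_closed :: "('a, 'b) ring_scheme \<Rightarrow> 'a set \<Rightarrow> bool" where
  "integrally_closed K A \<longleftrightarrow> integral_closure K A = A"

definition dedekind_domain :: "('a, 'b) ring_scheme \<Rightarrow> 'a set \<Rightarrow> bool" where
  "dedekind_domain K D \<longleftrightarrow>
     quotient_field_of K D \<and>
     noetherian_domain (K\<lparr>carrier := D\<rparr>) \<and>
     integrally_closed K D \<and>
     (\<forall>P. primeideal P (K\<lparr>carrier := D\<rparr>) \<and> P \<noteq> {\<zero>\<^bsub>K\<^esub>} \<longrightarrow> maximalideal P (K\<lparr>carrier := D\<rparr>)) \<and>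
     \<not> field (K\<lparr>carrier := D\<rparr>)"

text \<open>
  The library's \<open>Span\<close> is the set of linear combinations of a list with coefficients in an arbitrary
  set, so it also describes the \<open>A\<close>-submodule generated by the list when \<open>A\<close> is only a ring.
\<close>

definition finitely_generated_over :: "('a, 'b) ring_scheme \<Rightarrow> 'a set \<Rightarrow> 'a set \<Rightarrow> bool" where
  "finitely_generated_over K A M \<longleftrightarrow> (\<exists>us. set us \<subseteq> M \<and> M = ring.Span K A us)"

definition is_order :: "('a, 'b) ring_scheme \<Rightarrow> 'a set \<Rightarrow> bool" where
  "is_order K A \<longleftrightarrow>
     quotient_field_of K A \<and>
     dedekind_domain K (integral_closure K A) \<and>
     finitely_generated_over K A (integral_closure K A)"

definition conductor :: "('a, 'b) ring_scheme \<Rightarrow> 'a set \<Rightarrow> 'a set" where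
  "conductor K A = {x \<in> A. \<forall>d \<in> integral_closure K A. x \<otimes>\<^bsub>K\<^esub> d \<in> A}"

definition regular_ideal :: "('a, 'b) ring_scheme \<Rightarrow> 'a set \<Rightarrow> 'a set \<Rightarrow> bool" where
  "regular_ideal K A I \<longleftrightarrow> ideal I (K\<lparr>carrier := A\<rparr>) \<and> I <+>\<^bsub>K\<^esub> conductor K A = A"

definition idempotent_pair :: "('a, 'b) ring_scheme \<Rightarrow> 'a \<Rightarrow> 'a \<Rightarrow> bool" where
  "idempotent_pair R a b \<longleftrightarrow> a \<in> carrier R \<and> b \<in> carrier R \<and>
     (a \<otimes>\<^bsub>R\<^esub> (\<one>\<^bsub>R\<^esub> \<ominus>\<^bsub>R\<^esub> a) \<in> PIdl\<^bsub>R\<^esub> b \<or> b \<otimes>\<^bsub>R\<^esub> (\<one>\<^bsub>R\<^esub> \<ominus>\<^bsub>R\<^esub> b) \<in> PIdl\<^bsub>R\<^esub> a)"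

end

theory Submission
  imports Defs
begin

text \<open>
  Let \<open>D\<close> be the integral closure of \<open>O\<close> and choose \<open>p \<in> P\<close>, \<open>c\<close> in the conductor with
  \<open>p + c = 1\<close>. Then \<open>M = {d \<in> D. c d \<in> P}\<close> is a prime ideal of \<open>D\<close> lying over \<open>P\<close>. As \<open>D\<close> is
  Dedekind, \<open>M\<close> is locally principal: there are \<open>b \<in> M\<close> and \<open>s \<in> D - M\<close> with \<open>s M \<subseteq> b D\<close>, and
  by maximality \<open>s\<close> may be taken of the form \<open>1 - \<alpha>\<close> with \<open>\<alpha> \<in> M\<close>. Multiplying by \<open>c\<^sup>2\<close> gives
  \<open>c\<^sup>2 (1 - \<alpha>) P \<subseteq> (c b) O\<close>, where \<open>c b\<close> and \<open>a = 1 - c\<^sup>2 (1 - \<alpha>)\<close> lie in \<open>P\<close>. Hence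
  \<open>(1 - a) P \<subseteq> (c b) O\<close>, so that \<open>P\<close> is generated by the idempotent pair \<open>a, c b\<close>.
\<close>

section \<open>Ideals of a subring, expressed by the operations of the ambient ring\<close>

text \<open>\<open>a_inv\<close> is a description over the carrier, so the two inverses are not
  equal by unfolding; uniqueness of inverses in \<open>R\<close> identifies them.\<close>

lemma (in ring) subring_a_inv:
  assumes "subring A R" "x \<in> A"
  shows "a_inv (R\<lparr>carrier := A\<rparr>) x = \<ominus> x"
proof -
  interpret S: ring "R\<lparr>carrier := A\<rparr>" by (rule subring_is_ring[OF assms(1)])
  have "a_inv (R\<lparr>carrier := A\<rparr>) x \<in> A" "a_inv (R\<lparr>carrier := A\<rparr>) x \<oplus> x = \<zero>"
    using S.a_inv_closed[of x] S.l_neg[of x] assms(2) by simp_all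
  then show ?thesis
    using assms subringE(1)[OF assms(1)] by (metis minus_equality subsetD)
qed

text \<open>Closure under negation need not be listed, since it is multiplication by
  \<open>\<ominus> \<one>\<close>, an element of \<open>A\<close>.\<close>

lemma (in ring) subring_ideal_iff:
  assumes "subring A R"
  shows "ideal I (R\<lparr>carrier := A\<rparr>) \<longleftrightarrow> I \<subseteq> A \<and> \<zero> \<in> I \<and> (\<forall>x\<in>I. \<forall>y\<in>I. x \<oplus> y \<in> I) \<and>
    (\<forall>a\<in>A. \<forall>x\<in>I. a \<otimes> x \<in> I \<and> x \<otimes> a \<in> I)" (is "_ \<longleftrightarrow> ?rhs")
proof
  interpret S: ring "R\<lparr>carrier := A\<rparr>" by (rule subring_is_ring[OF assms])
  assume "ideal I (R\<lparr>carrier := A\<rparr>)"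
  then interpret I: ideal I "R\<lparr>carrier := A\<rparr>" .
  show ?rhs
    using I.a_subset I.zero_closed I.a_closed I.I_l_closed I.I_r_closed by simp
next
  interpret S: ring "R\<lparr>carrier := A\<rparr>" by (rule subring_is_ring[OF assms])
  assume r: ?rhs
  show "ideal I (R\<lparr>carrier := A\<rparr>)"
  proof (rule idealI[OF S.ring_axioms])
    show "subgroup I (add_monoid (R\<lparr>carrier := A\<rparr>))"
    proof (rule S.add.subgroupI)
      fix x assume x: "x \<in> I"
      have "\<ominus> \<one> \<in> A"
        using subringE(3,5)[OF assms] by blast
      then have "(\<ominus> \<one>) \<otimes> x \<in> I" using r x by blast
      moreover have "x \<in> carrier R" using x r subringE(1)[OF assms] by blast
      ultimately have "\<ominus> x \<in> I" by (simp add: l_minus)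
      then show "a_inv (R\<lparr>carrier := A\<rparr>) x \<in> I"
        using x r subring_a_inv[OF assms] by auto
    qed (use r in auto)
  qed (use r in auto)
qed

section \<open>Colon ideals and associated primes in Noetherian domains\<close>

text \<open>The ideal quotient \<open>(J : d)\<close>, that is, the annihilator of the class of
  \<open>d\<close> modulo \<open>J\<close>; the primes of this form are the associated primes of
  \<open>J\<close>.\<close>

definition (in ring) colon :: "'a set \<Rightarrow> 'a \<Rightarrow> 'a set" where
  "colon J d = {r \<in> carrier R. r \<otimes> d \<in> J}"

lemma (in cring) colon_ideal:
  assumes "ideal J R" "d \<in> carrier R"
  shows "ideal (colon J d) R"
proof -
  interpret J: ideal J R by fact
  have "ideal (colon J d) (R\<lparr>carrier := carrier R\<rparr>)"
    unfolding subring_ideal_iff[OF carrier_is_subring] colon_def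
    using assms(2) J.zero_closed J.a_closed J.I_l_closed
    by (auto simp: l_distr m_assoc m_lcomm)
  then show ?thesis by simp
qed

text \<open>By the ascending chain condition a nonempty chain contains its own union, so Zorn's
  lemma applies to any family of ideals, whether or not it is closed under unions.\<close>

lemma (in noetherian_ring) ideal_set_has_maximal:
  assumes "S \<noteq> {}" "\<And>I. I \<in> S \<Longrightarrow> ideal I R"
  obtains I where "I \<in> S" "\<And>J. \<lbrakk>J \<in> S; I \<subseteq> J\<rbrakk> \<Longrightarrow> J = I"
proof -
  have "\<exists>I\<in>S. \<forall>J\<in>S. I \<subseteq> J \<longrightarrow> J = I"
  proof (rule subset_Zorn)
    fix C assume C: "subset.chain S C"
    show "\<exists>U\<in>S. \<forall>V\<in>C. V \<subseteq> U"
    proof (cases "C = {}")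
      case False
      have "subset.chain {I. ideal I R} C"
        using C assms(2) unfolding subset_chain_def by blast
      then have "\<Union>C \<in> C" by (rule ideal_chain_is_trivial[OF False])
      moreover have "C \<subseteq> S" using C by (simp add: subset_chain_def)
      ultimately have "\<Union>C \<in> S" by (rule rev_subsetD)
      then show ?thesis by (intro bexI[of _ "\<Union>C"] ballI Union_upper)
    qed (use assms(1) in auto)
  qed
  then show thesis using that by blast
qed

text \<open>
  The colon ideals are only required to lie in \<open>M\<close>, not to be proper: this plays the role of
  localising at \<open>M\<close> and makes the associated prime that is found lie below \<open>M\<close>.
\<close>

lemma (in noetherian_domain) exists_prime_colon:
  assumes "primeideal M R" "ideal J R" "J \<subseteq> M"
  obtains d where "d \<in> carrier R" "primeideal (colon J d) R" "colon J d \<subseteq> M"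
proof -
  interpret M: primeideal M R by fact
  interpret J: ideal J R by fact
  have one: "\<one> \<notin> M" using M.I_notcarr M.one_imp_carrier by auto
  define S where "S = {colon J d | d. d \<in> carrier R \<and> colon J d \<subseteq> M}"
  have "colon J \<one> \<subseteq> M" using assms(3) by (auto simp: colon_def)
  then have "S \<noteq> {}" unfolding S_def by blast
  then obtain I where I: "I \<in> S" and max: "\<And>I'. \<lbrakk>I' \<in> S; I \<subseteq> I'\<rbrakk> \<Longrightarrow> I' = I"
    by (rule ideal_set_has_maximal) (auto simp: S_def colon_ideal[OF assms(2)])
  from I obtain d where d: "d \<in> carrier R" and Id: "I = colon J d" and IM: "I \<subseteq> M"
    unfolding S_def by blast
  have "primeideal I R"
  proof (rule primeidealI)
    show "ideal I R" unfolding Id by (rule colon_ideal[OF assms(2) d])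
    show "carrier R \<noteq> I" using IM one by blast
    fix u v assume u: "u \<in> carrier R" and v: "v \<in> carrier R" and uv: "u \<otimes> v \<in> I"
    have uvd: "u \<otimes> v \<otimes> d \<in> J" using uv by (simp add: Id colon_def)
    \<comment> \<open>Passing to a multiple of \<open>d\<close> can only enlarge the colon ideal, so
      maximality forces equality as long as the larger one stays inside \<open>M\<close>.\<close>
    have sub: "I \<subseteq> colon J (w \<otimes> d)" if "w \<in> carrier R" for w
      unfolding Id colon_def using that d m_lcomm[of _ w d] by (auto simp: J.I_l_closed)
    show "u \<in> I \<or> v \<in> I"
    proof (cases "colon J (u \<otimes> d) \<subseteq> M")
      case True
      then have "colon J (u \<otimes> d) = I" using max sub[OF u] u d unfolding S_def by blast
      moreover have "v \<in> colon J (u \<otimes> d)"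
        using uvd u v d by (simp add: colon_def m_ac)
      ultimately show ?thesis by blast
    next
      case False
      \<comment> \<open>A witness \<open>w\<close> outside \<open>M\<close> replaces
        \<open>u\<close> as the multiplier: primality of \<open>M\<close> cancels \<open>w\<close>
        and keeps \<open>colon J (w \<otimes> d)\<close> inside \<open>M\<close>, while this ideal
        contains \<open>u\<close>.\<close>
      then obtain w where w: "w \<in> carrier R" "w \<notin> M" and wd: "w \<otimes> (u \<otimes> d) \<in> J"
        by (auto simp: colon_def)
      have "colon J (w \<otimes> d) \<subseteq> M"
      proof
        fix y assume "y \<in> colon J (w \<otimes> d)"
        then have y: "y \<in> carrier R" "y \<otimes> (w \<otimes> d) \<in> J" by (auto simp: colon_def)
        then have "y \<otimes> w \<in> I" using w d by (simp add: Id colon_def m_assoc)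
        then show "y \<in> M" using M.I_prime y(1) w IM by blast
      qed
      then have "colon J (w \<otimes> d) = I" using max sub[OF w(1)] w(1) d unfolding S_def by blast
      moreover have "u \<in> colon J (w \<otimes> d)"
        using wd u w(1) d by (simp add: colon_def m_lcomm)
      ultimately show ?thesis by blast
    qed
  qed (rule is_cring)
  with that d IM show thesis unfolding Id by blast
qed

section \<open>Integrality of elements whose powers have a common denominator\<close>

text \<open>For a subring \<open>A\<close> this is the \<open>A\<close>-module spanned by the powers
  of \<open>x\<close> with exponent below \<open>n\<close>. Leading zeros are allowed, so the exact
  length \<open>n\<close> covers all smaller degrees too.\<close>

definition (in ring) poly_values :: "'a set \<Rightarrow> 'a \<Rightarrow> nat \<Rightarrow> 'a set" where
  "poly_values A x n = {eval p x | p. set p \<subseteq> A \<and> length p = n}"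

lemma (in ring) poly_values_Suc:
  "poly_values A x (Suc n) = {a \<otimes> x [^] n \<oplus> s | a s. a \<in> A \<and> s \<in> poly_values A x n}"
proof -
  have "eval p x \<in> {a \<otimes> x [^] n \<oplus> s | a s. a \<in> A \<and> s \<in> poly_values A x n}"
    if "set p \<subseteq> A" "length p = Suc n" for p
    using that by (cases p) (auto simp: poly_values_def)
  moreover have "a \<otimes> x [^] n \<oplus> eval p x \<in> poly_values A x (Suc n)"
    if "a \<in> A" "set p \<subseteq> A" "length p = n" for a p
    unfolding poly_values_def using that
    by (intro CollectI exI[of _ "a # p"]) auto
  ultimately show ?thesis unfolding poly_values_def by blast
qed

lemma (in cring) poly_values_module:
  assumes "subring A R" "x \<in> carrier R"
  shows "poly_values A x n \<subseteq> carrier R \<and> \<zero> \<in> poly_values A x n \<and>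
    (\<forall>s\<in>poly_values A x n. \<forall>t\<in>poly_values A x n. s \<oplus> t \<in> poly_values A x n) \<and>
    (\<forall>a\<in>A. \<forall>s\<in>poly_values A x n. a \<otimes> s \<in> poly_values A x n)"
proof (induction n)
  case 0
  have "poly_values A x 0 = {\<zero>}" by (auto simp: poly_values_def)
  then show ?case using subringE(1)[OF assms(1)] by auto
next
  case (Suc n)
  note A = subringE[OF assms(1)]
  have Ac: "a \<in> carrier R" if "a \<in> A" for a using A(1) that by blast
  have sc: "s \<in> carrier R" if "s \<in> poly_values A x n" for s using Suc that by blast
  have xn: "x [^] n \<in> carrier R" using assms(2) by simp
  show ?case
  proof (intro conjI ballI)
    show "poly_values A x (Suc n) \<subseteq> carrier R"
      unfolding poly_values_Suc using Ac sc xn by auto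
    have "\<zero> = \<zero> \<otimes> x [^] n \<oplus> \<zero>" using xn by simp
    then show "\<zero> \<in> poly_values A x (Suc n)"
      unfolding poly_values_Suc using A(2) Suc by blast
  next
    fix s t assume "s \<in> poly_values A x (Suc n)" "t \<in> poly_values A x (Suc n)"
    then obtain a s' b t' where
      s: "a \<in> A" "s' \<in> poly_values A x n" "s = a \<otimes> x [^] n \<oplus> s'" and
      t: "b \<in> A" "t' \<in> poly_values A x n" "t = b \<otimes> x [^] n \<oplus> t'"
      unfolding poly_values_Suc by blast
    have "s \<oplus> t = (a \<oplus> b) \<otimes> x [^] n \<oplus> (s' \<oplus> t')"
      unfolding s(3) t(3) using s(1,2) t(1,2) Ac sc xn by (simp add: l_distr a_ac)
    moreover have "a \<oplus> b \<in> A" using A(7) s(1) t(1) by blast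
    moreover have "s' \<oplus> t' \<in> poly_values A x n" using Suc s(2) t(2) by blast
    ultimately show "s \<oplus> t \<in> poly_values A x (Suc n)"
      unfolding poly_values_Suc by blast
  next
    fix a s assume a: "a \<in> A" and "s \<in> poly_values A x (Suc n)"
    then obtain b s' where
      s: "b \<in> A" "s' \<in> poly_values A x n" "s = b \<otimes> x [^] n \<oplus> s'"
      unfolding poly_values_Suc by blast
    have "a \<otimes> s = (a \<otimes> b) \<otimes> x [^] n \<oplus> a \<otimes> s'"
      unfolding s(3) using s(1,2) a Ac sc xn by (simp add: r_distr m_assoc)
    moreover have "a \<otimes> b \<in> A" using A(6) s(1) a by blast
    moreover have "a \<otimes> s' \<in> poly_values A x n" using Suc s(2) a by blast
    ultimately show "a \<otimes> s \<in> poly_values A x (Suc n)"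
      unfolding poly_values_Suc by blast
  qed
qed

lemma (in cring) poly_values_mono:
  assumes "subring A R" "x \<in> carrier R" "k \<le> n"
  shows "poly_values A x k \<subseteq> poly_values A x n"
  using assms(3)
proof (induction rule: dec_induct)
  case (step n)
  have "s \<in> poly_values A x (Suc n)" if s: "s \<in> poly_values A x n" for s
  proof -
    have "s = \<zero> \<otimes> x [^] n \<oplus> s"
      using s poly_values_module[OF assms(1,2), of n] assms(2) by auto
    then show ?thesis unfolding poly_values_Suc using s subringE(2)[OF assms(1)] by blast
  qed
  then show ?case using step by blast
qed simp

text \<open>
  If all \<open>m x\<^sup>n\<close> lie in \<open>A\<close>, then the \<open>A\<close>-modules generated by \<open>1, \<dots>, x\<^sup>n\<close> become ideals of \<open>A\<close> after
  multiplication by \<open>m\<close>. They form an ascending chain, which has to stop, and this yields a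
  monic equation for \<open>x\<close>.
\<close>

lemma (in domain) integral_if_powers_bounded:
  assumes A: "subring A R" and noeth: "noetherian_ring (R\<lparr>carrier := A\<rparr>)"
    and m: "m \<in> A" "m \<noteq> \<zero>" and x: "x \<in> carrier R"
    and bounded: "\<And>n::nat. m \<otimes> x [^] n \<in> A"
  shows "x \<in> integral_closure R A"
proof -
  interpret N: noetherian_ring "R\<lparr>carrier := A\<rparr>" by fact
  note AE = subringE[OF A]
  note pm = poly_values_module[OF A x]
  have mc: "m \<in> carrier R" using m AE(1) by blast
  define I where "I n = (\<lambda>s. m \<otimes> s) ` poly_values A x n" for n
  have mA: "m \<otimes> s \<in> A" if "s \<in> poly_values A x n" for s n
    using that
  proof (induction n arbitrary: s)
    case 0
    then show ?case using mc AE(2) by (auto simp: poly_values_def)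
  next
    case (Suc n)
    then obtain a t where s: "a \<in> A" "t \<in> poly_values A x n" "s = a \<otimes> x [^] n \<oplus> t"
      unfolding poly_values_Suc by blast
    have ac: "a \<in> carrier R" and tc: "t \<in> carrier R" using s AE(1) pm[of n] by blast+
    have "m \<otimes> s = a \<otimes> (m \<otimes> x [^] n) \<oplus> m \<otimes> t"
      unfolding s(3) using mc ac tc x by (simp add: r_distr m_lcomm)
    also have "\<dots> \<in> A" using AE(6,7) s(1) bounded Suc.IH[OF s(2)] by blast
    finally show ?case .
  qed
  have ideal: "ideal (I n) (R\<lparr>carrier := A\<rparr>)" for n
    unfolding subring_ideal_iff[OF A]
  proof (intro conjI ballI)
    show "I n \<subseteq> A" unfolding I_def using mA by blast
    have "\<zero> = m \<otimes> \<zero>" using mc by simp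
    then show "\<zero> \<in> I n" unfolding I_def using pm by blast
    fix y assume "y \<in> I n"
    then obtain s where s: "s \<in> poly_values A x n" "y = m \<otimes> s" unfolding I_def by blast
    have sc: "s \<in> carrier R" using s pm by blast
    {
      fix z assume "z \<in> I n"
      then obtain t where t: "t \<in> poly_values A x n" "z = m \<otimes> t" unfolding I_def by blast
      have tc: "t \<in> carrier R" using t pm by blast
      have "y \<oplus> z = m \<otimes> (s \<oplus> t)" using s(2) t(2) mc sc tc by (simp add: r_distr)
      then show "y \<oplus> z \<in> I n" unfolding I_def using pm s(1) t(1) by blast
    next
      fix a assume a: "a \<in> A"
      have ac: "a \<in> carrier R" using a AE(1) by blast
      have "a \<otimes> y = m \<otimes> (a \<otimes> s)" "y \<otimes> a = m \<otimes> (a \<otimes> s)"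
        using s(2) mc sc ac by (simp_all add: m_ac)
      then show "a \<otimes> y \<in> I n" "y \<otimes> a \<in> I n" unfolding I_def using pm s(1) a by auto
    }
  qed
  have mono: "I k \<subseteq> I n" if "k \<le> n" for k n
    unfolding I_def using poly_values_mono[OF A x that] by blast
  have "subset.chain {J. ideal J (R\<lparr>carrier := A\<rparr>)} (range I)"
    unfolding subset_chain_def using ideal mono by (auto; meson nat_le_linear subsetD)
  then have "\<Union>(range I) \<in> range I" by (rule N.ideal_chain_is_trivial[rotated]) simp
  then obtain n where n: "\<Union>(range I) = I n" by blast
  \<comment> \<open>\<open>x [^] n\<close> is the first power beyond those spanning
    \<open>poly_values A x n\<close>. It appears at index \<open>Suc n\<close>, and stationarity
    brings its \<open>m\<close>-multiple back into \<open>I n\<close>.\<close>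
  have "\<one> \<otimes> x [^] n \<oplus> \<zero> \<in> poly_values A x (Suc n)"
    unfolding poly_values_Suc using AE(3) pm by blast
  then have "x [^] n \<in> poly_values A x (Suc n)" using x by simp
  then have "m \<otimes> x [^] n \<in> I n" using n unfolding I_def by blast
  then obtain s where s: "s \<in> poly_values A x n" "m \<otimes> x [^] n = m \<otimes> s"
    unfolding I_def by blast
  have sc: "s \<in> carrier R" using s pm by blast
  have xs: "x [^] n = s" using m_lcancel[OF m(2) mc] s(2) sc x by simp
  \<comment> \<open>After cancelling \<open>m\<close>, the power \<open>x [^] n\<close> is a
    combination \<open>s\<close> of lower powers. A coefficient list for \<open>\<ominus> s\<close>,
    preceded by \<open>\<one>\<close>, is the monic equation.\<close>
  have "\<ominus> \<one> \<in> A" using AE(3,5) by blast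
  then have "(\<ominus> \<one>) \<otimes> s \<in> poly_values A x n" using pm s(1) by blast
  then have "\<ominus> s \<in> poly_values A x n" using sc by (simp add: l_minus)
  then obtain p where p: "set p \<subseteq> A" "length p = n" "eval p x = \<ominus> s"
    unfolding poly_values_def by auto
  have "eval (\<one> # p) x = \<zero>" using p xs x sc by (simp add: r_neg)
  moreover have "\<one> # p \<in> carrier (univ_poly R A)"
    using p(1) AE(3) by (simp add: univ_poly_carrier[symmetric] polynomial_def)
  ultimately show ?thesis
    unfolding integral_closure_def using x
    by (intro CollectI conjI bexI[of _ "\<one> # p"]) (simp_all del: eval.simps)
qed

lemma (in domain) subset_integral_closure:
  assumes "subring A R"
  shows "A \<subseteq> integral_closure R A"
proof
  fix a assume a: "a \<in> A"
  note AE = subringE[OF assms]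
  have ac: "a \<in> carrier R" using a AE(1) by blast
  have "eval [\<one>, \<ominus> a] a = \<zero>" using ac by (simp add: r_neg)
  moreover have "[\<one>, \<ominus> a] \<in> carrier (univ_poly R A)"
    using a AE(3,5) by (simp add: univ_poly_carrier[symmetric] polynomial_def)
  ultimately show "a \<in> integral_closure R A"
    unfolding integral_closure_def using ac
    by (intro CollectI conjI bexI[of _ "[\<one>, \<ominus> a]"]) (simp_all del: eval.simps)
qed

section \<open>Local principality of nonzero primes in a Dedekind domain\<close>

text \<open>An element \<open>x\<close> of the inverse fractional ideal of \<open>M\<close> that
  does not map \<open>M\<close> into itself gives some \<open>z\<close> in \<open>M\<close> with
  \<open>s = x z\<close> outside \<open>M\<close>; then \<open>s y = z (x y)\<close> with
  \<open>x y\<close> in \<open>D\<close> for all \<open>y\<close> in \<open>M\<close>, so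
  \<open>b = z\<close> works.\<close>

lemma dedekind_prime_locally_principal:
  fixes K (structure)
  assumes D: "dedekind_domain K D" and M: "primeideal M (K\<lparr>carrier := D\<rparr>)" and "M \<noteq> {\<zero>}"
  obtains b s where "b \<in> M" "s \<in> D" "s \<notin> M" "\<And>z. z \<in> M \<Longrightarrow> \<exists>e\<in>D. s \<otimes> z = b \<otimes> e"
proof -
  interpret K: field K using D unfolding dedekind_domain_def quotient_field_of_def by blast
  have sub: "subring D K" using D unfolding dedekind_domain_def quotient_field_of_def by blast
  interpret N: noetherian_domain "K\<lparr>carrier := D\<rparr>" using D unfolding dedekind_domain_def by blast
  interpret M: primeideal M "K\<lparr>carrier := D\<rparr>" by fact
  note DE = subringE[OF sub]
  have Dc: "z \<in> carrier K" if "z \<in> D" for z using that DE(1) by blast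
  have MD: "z \<in> D" if "z \<in> M" for z using that M.a_subset by auto
  have "\<zero> \<in> M" using M.zero_closed by simp
  then obtain m where m: "m \<in> M" "m \<noteq> \<zero>" using \<open>M \<noteq> {\<zero>}\<close> by blast
  note mD = MD[OF m(1)]
  let ?J = "PIdl\<^bsub>K\<lparr>carrier := D\<rparr>\<^esub> m"
  have J: "ideal ?J (K\<lparr>carrier := D\<rparr>)" using N.cgenideal_ideal mD by simp
  have "?J \<subseteq> M" using N.cgenideal_minimal[OF M.is_ideal m(1)] .
  from N.exists_prime_colon[OF M J this] obtain d where dD: "d \<in> D"
    and prime: "primeideal (N.colon ?J d) (K\<lparr>carrier := D\<rparr>)" and le: "N.colon ?J d \<subseteq> M"
    by auto
  have "m \<in> N.colon ?J d"
    unfolding N.colon_def cgenideal_def using mD dD Dc DE(6) K.m_comm by auto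
  then have "N.colon ?J d \<noteq> {\<zero>}" using m(2) by blast
  \<comment> \<open>The associated prime below \<open>M\<close> is nonzero because it contains
    \<open>m\<close>; hence it is maximal and coincides with \<open>M\<close>.\<close>
  then have "maximalideal (N.colon ?J d) (K\<lparr>carrier := D\<rparr>)"
    using D prime unfolding dedekind_domain_def by blast
  from maximalideal.I_maximal[OF this M.is_ideal le]
  have eq: "M = N.colon ?J d" using M.I_notcarr M.a_subset by simp
  \<comment> \<open>Since \<open>M\<close> is the colon ideal of \<open>d\<close> modulo
    \<open>m D\<close>, every product of \<open>d\<close> with an element of \<open>M\<close> is
    divisible by \<open>m\<close>, so \<open>d / m\<close> multiplies \<open>M\<close> into
    \<open>D\<close>.\<close>
  define x where "x = d \<otimes> inv m"
  have mc: "m \<in> carrier K" and dc: "d \<in> carrier K" and ic: "inv m \<in> carrier K" and im: "m \<otimes> inv m = \<one>"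
    using mD dD Dc m(2) K.field_Units by auto
  have xc: "x \<in> carrier K" unfolding x_def using dc ic by simp
  have mx: "m \<otimes> x = d" unfolding x_def using mc dc ic im by (simp add: K.m_lcomm)
  have xM: "x \<otimes> z \<in> D" if z: "z \<in> M" for z
  proof -
    have "z \<otimes> d \<in> ?J" using z eq by (simp add: N.colon_def)
    then obtain r where r: "r \<in> D" "z \<otimes> d = r \<otimes> m" unfolding cgenideal_def by auto
    have zc: "z \<in> carrier K" and rc: "r \<in> carrier K" using z r MD Dc by auto
    have "x \<otimes> z = (z \<otimes> d) \<otimes> inv m" unfolding x_def using dc zc ic by (simp add: K.m_ac)
    also have "\<dots> = r" unfolding r(2) using rc mc ic im by (simp add: K.m_assoc)
    finally show ?thesis using r(1) by simp
  qed
  \<comment> \<open>Otherwise \<open>m\<close> times every power of \<open>x\<close> lies in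
    \<open>M\<close>, so \<open>x\<close> is integral and lies in \<open>D\<close>. Then
    \<open>d = m x\<close> lies in \<open>m D\<close>, and the colon ideal \<open>M\<close> contains
    \<open>\<one>\<close>.\<close>
  have "\<exists>z\<in>M. x \<otimes> z \<notin> M"
  proof (rule ccontr)
    assume "\<not> ?thesis"
    then have st: "\<And>z. z \<in> M \<Longrightarrow> x \<otimes> z \<in> M" by blast
    have "m \<otimes> x [^] (n::nat) \<in> M" for n
    proof (induction n)
      case (Suc n)
      then show ?case using st[OF Suc] mc xc by (simp add: K.m_ac)
    qed (use m(1) mc in simp)
    then have "x \<in> integral_closure K D"
      using K.integral_if_powers_bounded[OF sub N.noetherian_ring_axioms mD m(2) xc] MD by blast
    then have "x \<in> D" using D unfolding dedekind_domain_def integrally_closed_def by blast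
    then have "d \<in> ?J" unfolding cgenideal_def using mx mc xc K.m_comm by force
    then have "\<one> \<in> M" unfolding eq N.colon_def using DE(3) dc by simp
    then show False using M.I_notcarr M.one_imp_carrier by simp
  qed
  then obtain z where z: "z \<in> M" "x \<otimes> z \<notin> M" by blast
  show thesis
  proof (rule that[OF z(1) xM[OF z(1)] z(2)])
    fix y assume y: "y \<in> M"
    have "x \<otimes> z \<otimes> y = z \<otimes> (x \<otimes> y)" using xc z(1) y MD Dc by (simp add: K.m_ac)
    then show "\<exists>e\<in>D. x \<otimes> z \<otimes> y = z \<otimes> e" using xM[OF y] by blast
  qed
qed

section \<open>Idempotent pairs and regular primes of an order\<close>

text \<open>Generation follows from \<open>z = z (1 - a) + z a\<close>. The case
  \<open>z = a\<close> of the hypothesis \<open>principal\<close> is already the idempotent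
  condition.\<close>

lemma (in domain) generated_by_idempotent_pair:
  assumes P: "ideal P R" and a: "a \<in> P" and b: "b \<in> P"
    and principal: "\<And>z. z \<in> P \<Longrightarrow> z \<otimes> (\<one> \<ominus> a) \<in> PIdl b"
  shows "idempotent_pair R a b \<and> P = Idl {a, b}"
proof -
  interpret P: ideal P R by fact
  have ac: "a \<in> carrier R" and bc: "b \<in> carrier R" using a b P.a_subset by auto
  have "P \<subseteq> Idl {a, b}"
  proof
    fix z assume z: "z \<in> P"
    have zc: "z \<in> carrier R" using z P.a_subset by blast
    interpret I: ideal "Idl {a, b}" R by (rule genideal_ideal) (use ac bc in simp)
    have ab: "{a, b} \<subseteq> Idl {a, b}" by (rule genideal_self) (use ac bc in simp)
    have "PIdl b \<subseteq> Idl {a, b}" by (rule cgenideal_minimal[OF I.is_ideal]) (use ab in simp)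
    then have "z \<otimes> (\<one> \<ominus> a) \<in> Idl {a, b}" using principal[OF z] by blast
    moreover have "z \<otimes> a \<in> Idl {a, b}" using I.I_l_closed ab zc by blast
    ultimately have "z \<otimes> (\<one> \<ominus> a) \<oplus> z \<otimes> a \<in> Idl {a, b}" by (rule I.a_closed)
    moreover have "z \<otimes> (\<one> \<ominus> a) \<oplus> z \<otimes> a = z"
      using zc ac by (simp add: minus_eq r_distr[symmetric] a_assoc l_neg)
    ultimately show "z \<in> Idl {a, b}" by simp
  qed
  moreover have "Idl {a, b} \<subseteq> P" by (rule genideal_minimal[OF P]) (use a b in simp)
  ultimately show ?thesis
    unfolding idempotent_pair_def using ac bc principal[OF a] by blast
qed

lemma regular_prime_idempotent_pair:
  fixes K (structure)
  assumes ord: "is_order K A" and P: "primeideal P (K\<lparr>carrier := A\<rparr>)"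
    and reg: "regular_ideal K A P"
  shows "\<exists>a b. idempotent_pair (K\<lparr>carrier := A\<rparr>) a b \<and> P = Idl\<^bsub>K\<lparr>carrier := A\<rparr>\<^esub> {a, b}"
proof -
  let ?R = "K\<lparr>carrier := A\<rparr>"
  define D where "D = integral_closure K A"
  have ded: "dedekind_domain K D" using ord unfolding is_order_def D_def by blast
  interpret K: field K using ord unfolding is_order_def quotient_field_of_def by blast
  have subA: "subring A K" using ord unfolding is_order_def quotient_field_of_def by blast
  have subD: "subring D K" using ded unfolding dedekind_domain_def quotient_field_of_def by blast
  interpret R: domain ?R by (rule K.subring_is_domain[OF subA])
  interpret DD: domain "K\<lparr>carrier := D\<rparr>" by (rule K.subring_is_domain[OF subD])
  interpret P: primeideal P ?R by fact
  note AE = subringE[OF subA] and DE = subringE[OF subD]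
  have AD: "z \<in> D" if "z \<in> A" for z
    using K.subset_integral_closure[OF subA] that unfolding D_def by blast
  have Dc: "z \<in> carrier K" if "z \<in> D" for z using that DE(1) by blast
  have PA: "z \<in> A" if "z \<in> P" for z using that P.a_subset by auto
  have Pmult: "r \<otimes> z \<in> P" if "r \<in> A" "z \<in> P" for r z using P.I_l_closed that by simp
  have Padd: "y \<oplus> z \<in> P" if "y \<in> P" "z \<in> P" for y z using P.a_closed that by simp
  have Pprime: "y \<in> P \<or> z \<in> P" if "y \<in> A" "z \<in> A" "y \<otimes> z \<in> P" for y z
    using P.I_prime that by simp
  have zeroP: "\<zero> \<in> P" using P.zero_closed by simp
  have oneP: "\<one> \<notin> P" using P.I_notcarr P.one_imp_carrier by auto
  show ?thesis
  \<comment> \<open>The zero prime is treated apart, because the Dedekind property makes only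
    nonzero primes maximal.\<close>
  proof (cases "P = {\<zero>}")
    case True
    have "idempotent_pair ?R \<zero> \<zero> \<and> P = Idl\<^bsub>?R\<^esub> {\<zero>, \<zero>}"
    proof (rule R.generated_by_idempotent_pair[OF P.is_ideal zeroP zeroP])
      fix z assume "z \<in> P"
      then have "z \<otimes>\<^bsub>?R\<^esub> (\<one>\<^bsub>?R\<^esub> \<ominus>\<^bsub>?R\<^esub> \<zero>) = \<zero>" using True R.minus_closed[of "\<one>" "\<zero>"] AE by auto
      then show "z \<otimes>\<^bsub>?R\<^esub> (\<one>\<^bsub>?R\<^esub> \<ominus>\<^bsub>?R\<^esub> \<zero>) \<in> PIdl\<^bsub>?R\<^esub> \<zero>"
        unfolding cgenideal_def using AE(2) by force
    qed
    then show ?thesis by blast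
  next
    case False
    have "\<one> \<in> P <+>\<^bsub>K\<^esub> conductor K A" using reg AE(3) unfolding regular_ideal_def by simp
    then obtain p c where p: "p \<in> P" and cf: "c \<in> conductor K A" and pc: "p \<oplus> c = \<one>"
      unfolding set_add_def' by auto
    have cA: "c \<in> A" and cD: "\<And>d. d \<in> D \<Longrightarrow> c \<otimes> d \<in> A"
      using cf unfolding conductor_def D_def by auto
    have cc: "c \<in> carrier K" and pK: "p \<in> carrier K" using cA p PA AD Dc by auto
    have cP: "c \<notin> P" using Padd[OF p] oneP pc by metis
    \<comment> \<open>As \<open>c\<close> is outside \<open>P\<close> and multiplies
      \<open>D\<close> into \<open>A\<close>, this is the intersection of \<open>D\<close> with the
      extension of \<open>P\<close> to the localisation of \<open>A\<close> at
      \<open>P\<close>.\<close>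
    define M where "M = {d \<in> D. c \<otimes> d \<in> P}"
    have PM: "z \<in> M" if "z \<in> P" for z
      unfolding M_def using that AD PA Pmult[OF cA] by blast
    have M: "primeideal M (K\<lparr>carrier := D\<rparr>)"
    proof (rule primeidealI)
      have mult: "d \<otimes> e \<in> M" if "d \<in> D" "e \<in> M" for d e
      proof -
        have e: "e \<in> D" "c \<otimes> e \<in> P" using that by (auto simp: M_def)
        \<comment> \<open>The extra factor \<open>c\<close> moves both \<open>d\<close> and
          \<open>e\<close> into \<open>A\<close>; primality of \<open>P\<close> then removes it
          again.\<close>
        have "c \<otimes> (c \<otimes> (d \<otimes> e)) = (c \<otimes> d) \<otimes> (c \<otimes> e)"
          using cc e(1) that(1) Dc by (simp add: K.m_ac)
        also have "\<dots> \<in> P" using Pmult[OF cD[OF that(1)] e(2)] .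
        finally have "c \<otimes> (d \<otimes> e) \<in> P" using Pprime cA cP cD DE(6) e(1) that(1) by blast
        then show ?thesis unfolding M_def using DE(6) e(1) that(1) by blast
      qed
      show "ideal M (K\<lparr>carrier := D\<rparr>)"
        unfolding K.subring_ideal_iff[OF subD]
      proof (intro conjI ballI)
        show "M \<subseteq> D" unfolding M_def by blast
        show "\<zero> \<in> M" using PM zeroP .
        fix x y assume "x \<in> M" "y \<in> M"
        then show "x \<oplus> y \<in> M"
          unfolding M_def using DE(7) Padd cc Dc by (auto simp: K.r_distr)
      next
        fix d e assume "d \<in> D" "e \<in> M"
        then have "d \<otimes> e \<in> M" "e \<otimes> d = d \<otimes> e"
          using mult K.m_comm Dc by (blast, simp add: M_def)
        then show "d \<otimes> e \<in> M" "e \<otimes> d \<in> M" by simp_all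
      qed
      show "carrier (K\<lparr>carrier := D\<rparr>) \<noteq> M"
      proof -
        have "\<one> \<notin> M" unfolding M_def using cP cc by simp
        then show ?thesis using DE(3) by auto
      qed
      fix d e assume "d \<in> carrier (K\<lparr>carrier := D\<rparr>)" "e \<in> carrier (K\<lparr>carrier := D\<rparr>)"
        and "d \<otimes>\<^bsub>K\<lparr>carrier := D\<rparr>\<^esub> e \<in> M"
      then have d: "d \<in> D" and e: "e \<in> D" and de: "c \<otimes> (d \<otimes> e) \<in> P"
        by (auto simp: M_def)
      have "(c \<otimes> d) \<otimes> (c \<otimes> e) = c \<otimes> (c \<otimes> (d \<otimes> e))"
        using cc d e Dc by (simp add: K.m_ac)
      then have "(c \<otimes> d) \<otimes> (c \<otimes> e) \<in> P" using Pmult[OF cA de] by simp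
      then show "d \<in> M \<or> e \<in> M" using Pprime cD d e unfolding M_def by blast
    qed (rule DD.is_cring)
    interpret M: primeideal M "K\<lparr>carrier := D\<rparr>" by (rule M)
    have "M \<noteq> {\<zero>}" using PM False zeroP by blast
    from dedekind_prime_locally_principal[OF ded M this] obtain b s where b: "b \<in> M"
      and s: "s \<in> D" "s \<notin> M" and sM: "\<And>z. z \<in> M \<Longrightarrow> \<exists>e\<in>D. s \<otimes> z = b \<otimes> e"
      by metis
    have maxM: "maximalideal M (K\<lparr>carrier := D\<rparr>)"
      using ded M \<open>M \<noteq> {\<zero>}\<close> unfolding dedekind_domain_def by blast
    \<comment> \<open>\<open>M\<close> is maximal and \<open>s\<close> lies outside it, so
      \<open>s\<close> is invertible modulo \<open>M\<close>; thus \<open>t s\<close> has the form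
      \<open>1 - \<alpha>\<close>.\<close>
    obtain t \<alpha> where t: "t \<in> D" and \<alpha>: "\<alpha> \<in> M" and st: "t \<otimes> s \<oplus> \<alpha> = \<one>"
    proof -
      let ?S = "K\<lparr>carrier := D\<rparr>"
      let ?J = "PIdl\<^bsub>?S\<^esub> s <+>\<^bsub>?S\<^esub> M"
      have sI: "ideal (PIdl\<^bsub>?S\<^esub> s) ?S" using DD.cgenideal_ideal s(1) by simp
      have J: "ideal ?J ?S" by (rule DD.add_ideals[OF sI M.is_ideal])
      have in_J: "r \<otimes> s \<oplus> \<beta> \<in> ?J" if "r \<in> D" "\<beta> \<in> M" for r \<beta>
        unfolding set_add_def' cgenideal_def using that by auto
      have "M \<subseteq> ?J"
      proof
        fix \<beta> assume \<beta>: "\<beta> \<in> M"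
        then have "\<zero> \<otimes> s \<oplus> \<beta> = \<beta>" using Dc s(1) by (simp add: M_def)
        then show "\<beta> \<in> ?J" using in_J[OF DE(2) \<beta>] by simp
      qed
      moreover have "s \<in> ?J"
      proof -
        have "\<one> \<otimes> s \<oplus> \<zero> = s" using Dc s(1) by simp
        then show ?thesis using in_J[OF DE(3) PM[OF zeroP]] by simp
      qed
      moreover have "?J \<subseteq> carrier ?S"
        using J ideal.axioms(1) additive_subgroup.a_subset by blast
      ultimately have "?J = D" using maximalideal.I_maximal[OF maxM J] s(2) by auto
      then have "\<one> \<in> ?J" using DE(3) by simp
      then show thesis using that unfolding set_add_def' cgenideal_def by auto
    qed
    have \<alpha>D: "\<alpha> \<in> D" and bD: "b \<in> D" using \<alpha> b by (auto simp: M_def)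
    note carr = Dc[OF t] Dc[OF s(1)] Dc[OF \<alpha>D] Dc[OF bD] cc pK
    \<comment> \<open>Of the two factors \<open>c\<close>, one will carry the cofactor
      \<open>t e\<close> from \<open>D\<close> into \<open>A\<close>, the other will carry
      \<open>b\<close> from \<open>M\<close> into \<open>P\<close>.\<close>
    define u where "u = c \<otimes> (c \<otimes> (t \<otimes> s))"
    \<comment> \<open>\<open>a\<close> is \<open>1 - c\<^sup>2 (1 - \<alpha>)\<close>, rewritten with \<open>1 - c = p\<close> so that it visibly lies in \<open>P\<close>.\<close>
    define a where "a = p \<oplus> (c \<otimes> p \<oplus> c \<otimes> (c \<otimes> \<alpha>))"
    have uA: "u \<in> A" unfolding u_def using cA cD AE(6) DE(6) t s(1) by blast
    have aP: "a \<in> P" unfolding a_def using Padd Pmult cA p \<alpha> by (simp add: M_def)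
    have uc: "u \<in> carrier K" and ac: "a \<in> carrier K" using uA aP PA AD Dc by auto
    \<comment> \<open>The relation \<open>t s + \<alpha> = 1\<close> reduces the sum to
      \<open>p + c (p + c)\<close>, and \<open>p + c = 1\<close> is then used twice.\<close>
    have "u \<oplus> a = p \<oplus> (c \<otimes> p \<oplus> c \<otimes> (c \<otimes> (t \<otimes> s \<oplus> \<alpha>)))"
      unfolding u_def a_def using carr by (simp add: K.r_distr K.a_ac)
    also have "\<dots> = p \<oplus> c \<otimes> (p \<oplus> c)" unfolding st using carr by (simp add: K.r_distr)
    also have "\<dots> = \<one>" unfolding pc using carr pc by simp
    finally have ua: "u \<oplus> a = \<one>" .
    have "\<one>\<^bsub>?R\<^esub> \<ominus>\<^bsub>?R\<^esub> a = \<one> \<oplus> \<ominus> a"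
      using K.subring_a_inv[OF subA PA[OF aP]] by (simp add: a_minus_def)
    also have "\<dots> = u" using ua uc ac by (metis K.a_assoc K.a_inv_closed K.r_neg K.r_zero)
    finally have oma: "\<one>\<^bsub>?R\<^esub> \<ominus>\<^bsub>?R\<^esub> a = u" .
    have cbP: "c \<otimes> b \<in> P" using b by (simp add: M_def)
    have "idempotent_pair ?R a (c \<otimes> b) \<and> P = Idl\<^bsub>?R\<^esub> {a, c \<otimes> b}"
    proof (rule R.generated_by_idempotent_pair[OF P.is_ideal aP cbP])
      fix z assume z: "z \<in> P"
      have zc: "z \<in> carrier K" using z PA AD Dc by blast
      obtain e where e: "e \<in> D" "s \<otimes> z = b \<otimes> e" using sM[OF PM[OF z]] by blast
      have "z \<otimes> u = c \<otimes> (c \<otimes> (t \<otimes> (s \<otimes> z)))" unfolding u_def using carr zc by (simp add: K.m_ac)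
      also have "\<dots> = (c \<otimes> (t \<otimes> e)) \<otimes> (c \<otimes> b)"
        unfolding e(2) using carr Dc[OF e(1)] by (simp add: K.m_ac)
      finally have "z \<otimes> u = (c \<otimes> (t \<otimes> e)) \<otimes> (c \<otimes> b)" .
      moreover have "c \<otimes> (t \<otimes> e) \<in> A" using cD DE(6) t e(1) by blast
      ultimately show "z \<otimes>\<^bsub>?R\<^esub> (\<one>\<^bsub>?R\<^esub> \<ominus>\<^bsub>?R\<^esub> a) \<in> PIdl\<^bsub>?R\<^esub> (c \<otimes> b)"
        unfolding oma cgenideal_def by auto
    qed
    then show ?thesis by blast
  qed
qed

section \<open>The integrally closed case\<close>

text \<open>The conductor is the whole ring here, so comaximality with it is automatic.\<close>

lemma integrally_closed_regular_ideal:
  fixes K (structure)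
  assumes "subring A K" "field K" "integrally_closed K A" "ideal P (K\<lparr>carrier := A\<rparr>)"
  shows "regular_ideal K A P"
proof -
  interpret K: field K by fact
  note AE = subringE[OF assms(1)]
  have P: "P \<subseteq> A" "\<zero> \<in> P"
    using assms(4) unfolding K.subring_ideal_iff[OF assms(1)] by simp_all
  have "conductor K A = A"
    using assms(3) AE(6) unfolding conductor_def integrally_closed_def by auto
  moreover have "P <+>\<^bsub>K\<^esub> A = A"
  proof
    show "P <+>\<^bsub>K\<^esub> A \<subseteq> A" unfolding set_add_def' using AE(7) P(1) by blast
    show "A \<subseteq> P <+>\<^bsub>K\<^esub> A"
    proof
      fix x assume x: "x \<in> A"
      then have "x = \<zero> \<oplus> x" using AE(1) by (simp add: subset_iff)
      then show "x \<in> P <+>\<^bsub>K\<^esub> A" unfolding set_add_def' using x P(2) by blast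
    qed
  qed
  ultimately show ?thesis unfolding regular_ideal_def using assms(4) by simp
qed

theorem proposition2p3:
  fixes K :: "('a, 'b) ring_scheme" and A :: "'a set"
  assumes "is_order K A"
  shows "(\<forall>P. primeideal P (K\<lparr>carrier := A\<rparr>) \<and> regular_ideal K A P \<longrightarrow>
            (\<exists>a b. idempotent_pair (K\<lparr>carrier := A\<rparr>) a b \<and>
                   P = Idl\<^bsub>K\<lparr>carrier := A\<rparr>\<^esub> {a, b})) \<and>
         (integrally_closed K A \<longrightarrow>
           (\<forall>P. primeideal P (K\<lparr>carrier := A\<rparr>) \<longrightarrow>
              (\<exists>a b. idempotent_pair (K\<lparr>carrier := A\<rparr>) a b \<and>
                     P = Idl\<^bsub>K\<lparr>carrier := A\<rparr>\<^esub> {a, b})))"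
proof (intro conjI impI allI; (elim conjE)?)
  fix P assume "primeideal P (K\<lparr>carrier := A\<rparr>)" "regular_ideal K A P"
  then show "\<exists>a b. idempotent_pair (K\<lparr>carrier := A\<rparr>) a b \<and> P = Idl\<^bsub>K\<lparr>carrier := A\<rparr>\<^esub> {a, b}"
    by (rule regular_prime_idempotent_pair[OF assms])
next
  fix P assume closed: "integrally_closed K A" and P: "primeideal P (K\<lparr>carrier := A\<rparr>)"
  have "subring A K" "field K"
    using assms unfolding is_order_def quotient_field_of_def by simp_all
  then have "regular_ideal K A P"
    using closed primeideal.axioms(1)[OF P] by (rule integrally_closed_regular_ideal)
  with P show "\<exists>a b. idempotent_pair (K\<lparr>carrier := A\<rparr>) a b \<and> P = Idl\<^bsub>K\<lparr>carrier := A\<rparr>\<^esub> {a, b}"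
    by (rule regular_prime_idempotent_pair[OF assms])
qed

end
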